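(* Let $\mathcal{F}=\{f_\beta|_{\{|z|<1\}}: 1<\beta<\theta_2^{-1}\}$ be endowed with the topology of uniform convergence on compact subsets of the open unit disk, and let $\beta\in(1,\theta_2^{-1})$. (i) If $\beta$ is a nonsimple Parry number, then $\lim_{\gamma\to\beta^-}f_\gamma(z)=f_\beta(z)=\lim_{\gamma\to\beta^+}f_\gamma(z)$ in $\mathcal{F}$. (ii) If $\beta$ is a simple Parry number and $N$ is the minimal integer with $T_\beta^N(1)=0$, then in $\mathcal{F}$ $$\lim_{\gamma\to\beta^+}f_\gamma(z)=f_\beta(z),\qquad \lim_{\gamma\to\beta^-}f_\gamma(z)=\frac{f_\beta(z)}{1-z^N}.$$
   Context: $\theta_2^{-1}=(1+\sqrt5)/2$. For real $\beta>1$, $T_\beta(x)=\{\beta x\}$, $t_i=\lfloor\beta T_\beta^{i-1}(1)\rfloor$, $d_\beta(1)=0.t_1t_2\ldots$, and the Parry Upper function is $f_\beta(z)=-1+\sum_{i\ge1}t_iz^i$. $\beta$ is a Parry number if $d_\beta(1)$ is finite or eventually periodic, simple if $d_\beta(1)$ is finite (i.e. $T_\beta^N(1)=0$ for some $N$), nonsimple otherwise. *)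

theory Defs
  imports "HOL-Analysis.Analysis"
begin

section \<open>The \<open>\<beta>\<close>-transformation, expansion of 1 and Parry numbers\<close>

definition beta_trans :: "real \<Rightarrow> real \<Rightarrow> real" where
  "beta_trans \<beta> x = frac (\<beta> * x)"

text \<open>The digits \<open>t\<^sub>i\<close> of \<open>d\<^sub>\<beta>(1)\<close> are indexed from 1; index 0 is never used.\<close>

definition digit :: "real \<Rightarrow> nat \<Rightarrow> int" where
  "digit \<beta> i = \<lfloor>\<beta> * (beta_trans \<beta> ^^ (i - 1)) 1\<rfloor>"

definition finite_expansion :: "real \<Rightarrow> bool" where
  "finite_expansion \<beta> \<longleftrightarrow> (\<exists>n. \<forall>i>n. digit \<beta> i = 0)"

definition eventually_periodic_expansion :: "real \<Rightarrow> bool" where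
  "eventually_periodic_expansion \<beta> \<longleftrightarrow> (\<exists>m p. p \<ge> 1 \<and> (\<forall>i>m. digit \<beta> (i + p) = digit \<beta> i))"

definition Parry_number :: "real \<Rightarrow> bool" where
  "Parry_number \<beta> \<longleftrightarrow> \<beta> > 1 \<and> (finite_expansion \<beta> \<or> eventually_periodic_expansion \<beta>)"

definition simple_Parry_number :: "real \<Rightarrow> bool" where
  "simple_Parry_number \<beta> \<longleftrightarrow> Parry_number \<beta> \<and> finite_expansion \<beta>"

definition nonsimple_Parry_number :: "real \<Rightarrow> bool" where
  "nonsimple_Parry_number \<beta> \<longleftrightarrow> Parry_number \<beta> \<and> \<not> simple_Parry_number \<beta>"

lemma beta_trans_iter_bounds:
  "0 \<le> (beta_trans \<beta> ^^ n) 1" "(beta_trans \<beta> ^^ n) 1 \<le> 1"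
  by (induction n) (auto simp: beta_trans_def frac_lt_1 less_imp_le)

text \<open>In particular the least \<open>N\<close> with \<open>T\<^sub>\<beta>\<^sup>N(1) = 0\<close> is well defined for a simple Parry number.\<close>

lemma finite_expansion_iff:
  assumes "\<beta> > 1"
  shows "finite_expansion \<beta> \<longleftrightarrow> (\<exists>N. (beta_trans \<beta> ^^ N) 1 = 0)"
proof
  assume "finite_expansion \<beta>"
  then obtain n where n: "digit \<beta> i = 0" if "i > n" for i
    by (auto simp: finite_expansion_def)
  define x where "x = (beta_trans \<beta> ^^ n) 1"
  have iter: "(beta_trans \<beta> ^^ (n + k)) 1 = \<beta> ^ k * x" for k
  proof (induction k)
    case (Suc k)
    have "\<lfloor>\<beta> * (beta_trans \<beta> ^^ (n + k)) 1\<rfloor> = 0"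
      using n[of "Suc (n + k)"] by (simp add: digit_def)
    then have "(beta_trans \<beta> ^^ (n + Suc k)) 1 = \<beta> * (beta_trans \<beta> ^^ (n + k)) 1"
      by (simp add: beta_trans_def frac_def)
    then show ?case
      by (simp add: Suc)
  qed (simp add: x_def)
  have "x = 0"
  proof (rule ccontr)
    assume "x \<noteq> 0"
    then have "x > 0"
      using beta_trans_iter_bounds(1)[where \<beta> = \<beta> and n = n] by (simp add: x_def)
    obtain k where "\<beta> ^ k > 1 / x"
      using real_arch_pow[OF assms] by blast
    then have "\<beta> ^ k * x > 1"
      using \<open>x > 0\<close> by (simp add: field_simps)
    then show False
      using beta_trans_iter_bounds(2)[where \<beta> = \<beta> and n = "n + k"] iter[of k] by simp
  qed
  then show "\<exists>N. (beta_trans \<beta> ^^ N) 1 = 0"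
    using x_def by metis
next
  assume "\<exists>N. (beta_trans \<beta> ^^ N) 1 = 0"
  then obtain N where N: "(beta_trans \<beta> ^^ N) 1 = 0" by blast
  have iter: "(beta_trans \<beta> ^^ (N + k)) 1 = 0" for k
  proof (induction k)
    case (Suc k)
    then show ?case
      by (simp add: beta_trans_def[of \<beta> 0])
  qed (simp add: N)
  have "digit \<beta> i = 0" if "i > N" for i
    using iter[of "i - 1 - N"] that by (simp add: digit_def)
  then show "finite_expansion \<beta>"
    unfolding finite_expansion_def by blast
qed

section \<open>The Parry Upper function\<close>

text \<open>The series is only considered for \<open>|z| < 1\<close>, where it converges because the digits are bounded.\<close>

definition Parry_upper :: "real \<Rightarrow> complex \<Rightarrow> complex" where
  "Parry_upper \<beta> z = -1 + (\<Sum>i. of_int (digit \<beta> (Suc i)) * z ^ Suc i)"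

abbreviation unit_disk :: "complex set" where
  "unit_disk \<equiv> ball 0 1"

definition Parry_upper_disk :: "real \<Rightarrow> complex \<Rightarrow> complex" where
  "Parry_upper_disk \<beta> = restrict (Parry_upper \<beta>) unit_disk"

section \<open>Uniform convergence on compact subsets\<close>

text \<open>Functions on \<open>D\<close> are represented by the elements of \<^term>\<open>extensional D\<close>.\<close>

definition compact_convergence_topology ::
  "'a::topological_space set \<Rightarrow> ('a \<Rightarrow> 'b::metric_space) topology" where
  "compact_convergence_topology D = topology (\<lambda>U. U \<subseteq> extensional D \<and>
     (\<forall>f\<in>U. \<exists>K \<epsilon>. compact K \<and> K \<subseteq> D \<and> \<epsilon> > 0 \<and>
        {g \<in> extensional D. \<forall>z\<in>K. dist (g z) (f z) < \<epsilon>} \<subseteq> U))"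

lemma openin_compact_convergence_topology:
  fixes D :: "'a::topological_space set" and U :: "('a \<Rightarrow> 'b::metric_space) set"
  shows "openin (compact_convergence_topology D) U \<longleftrightarrow> U \<subseteq> extensional D \<and>
     (\<forall>f\<in>U. \<exists>K \<epsilon>. compact K \<and> K \<subseteq> D \<and> \<epsilon> > 0 \<and>
        {g \<in> extensional D. \<forall>z\<in>K. dist (g z) (f z) < \<epsilon>} \<subseteq> U)"
proof -
  define P :: "('a \<Rightarrow> 'b) \<Rightarrow> ('a \<Rightarrow> 'b) set \<Rightarrow> bool" where
    "P = (\<lambda>f U. \<exists>K \<epsilon>. compact K \<and> K \<subseteq> D \<and> \<epsilon> > 0 \<and>
        {g \<in> extensional D. \<forall>z\<in>K. dist (g z) (f z) < \<epsilon>} \<subseteq> U)"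
  have mono: "P f V" if "P f U" "U \<subseteq> V" for f U V
    using that unfolding P_def by (meson subset_trans)
  have inter: "P f (U \<inter> V)" if U: "P f U" and V: "P f V" for f U V
  proof -
    obtain K \<epsilon> where 1: "compact K" "K \<subseteq> D" "\<epsilon> > 0"
      "{g \<in> extensional D. \<forall>z\<in>K. dist (g z) (f z) < \<epsilon>} \<subseteq> U"
      using U unfolding P_def by blast
    obtain L \<delta> where 2: "compact L" "L \<subseteq> D" "\<delta> > 0"
      "{g \<in> extensional D. \<forall>z\<in>L. dist (g z) (f z) < \<delta>} \<subseteq> V"
      using V unfolding P_def by blast
    have "{g \<in> extensional D. \<forall>z\<in>K \<union> L. dist (g z) (f z) < min \<epsilon> \<delta>} \<subseteq> U \<inter> V"
      using 1(4) 2(4) by auto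
    moreover have "compact (K \<union> L)" "K \<union> L \<subseteq> D" "min \<epsilon> \<delta> > 0"
      using 1 2 by auto
    ultimately show ?thesis
      unfolding P_def by blast
  qed
  have "istopology (\<lambda>U. U \<subseteq> extensional D \<and> (\<forall>f\<in>U. P f U))"
    unfolding istopology_def
  proof (intro conjI allI impI)
    show "\<And>S T. S \<subseteq> extensional D \<and> (\<forall>f\<in>S. P f S) \<Longrightarrow>
        T \<subseteq> extensional D \<and> (\<forall>f\<in>T. P f T) \<Longrightarrow> S \<inter> T \<subseteq> extensional D"
      by blast
    show "\<And>S T. S \<subseteq> extensional D \<and> (\<forall>f\<in>S. P f S) \<Longrightarrow>
        T \<subseteq> extensional D \<and> (\<forall>f\<in>T. P f T) \<Longrightarrow> \<forall>f\<in>S \<inter> T. P f (S \<inter> T)"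
      using inter by blast
    show "\<And>\<K>. \<forall>K\<in>\<K>. K \<subseteq> extensional D \<and> (\<forall>f\<in>K. P f K) \<Longrightarrow> \<Union> \<K> \<subseteq> extensional D"
      by blast
    show "\<forall>f\<in>\<Union>\<K>. P f (\<Union>\<K>)"
      if H: "\<forall>K\<in>\<K>. K \<subseteq> extensional D \<and> (\<forall>f\<in>K. P f K)" for \<K>
    proof
      fix f assume "f \<in> \<Union>\<K>"
      then obtain K where "K \<in> \<K>" "f \<in> K" by blast
      then show "P f (\<Union>\<K>)" using H mono[of f K "\<Union>\<K>"] by blast
    qed
  qed
  then show ?thesis
    unfolding compact_convergence_topology_def P_def by (simp add: topology_inverse')
qed

lemma topspace_compact_convergence_topology [simp]:
  "topspace (compact_convergence_topology D) = extensional D"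
proof -
  have "\<exists>K (\<epsilon>::real). compact K \<and> K \<subseteq> D \<and> \<epsilon> > 0" for D :: "'c::topological_space set"
    by (rule exI[of _ "{}"], rule exI[of _ 1]) auto
  then have "openin (compact_convergence_topology D) (extensional D)"
    unfolding openin_compact_convergence_topology by blast
  moreover have "topspace (compact_convergence_topology D) \<subseteq> extensional D"
    using openin_topspace openin_compact_convergence_topology by blast
  ultimately show ?thesis
    using openin_subset by blast
qed

lemma limitin_compact_convergence_topology:
  assumes "l \<in> extensional D" and "\<And>x. f x \<in> extensional D"
  shows "limitin (compact_convergence_topology D) f l F \<longleftrightarrow>
    (\<forall>K. compact K \<longrightarrow> K \<subseteq> D \<longrightarrow> uniform_limit K f l F)"
proof
  assume L: "limitin (compact_convergence_topology D) f l F"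
  show "\<forall>K. compact K \<longrightarrow> K \<subseteq> D \<longrightarrow> uniform_limit K f l F"
  proof (intro allI impI)
    fix K assume K: "compact K" "K \<subseteq> D"
    show "uniform_limit K f l F"
    proof (rule uniform_limitI)
      fix e :: real assume "e > 0"
      define U where "U = {g \<in> extensional D. \<exists>d<e. \<forall>z\<in>K. dist (g z) (l z) < d}"
      have "openin (compact_convergence_topology D) U"
        unfolding openin_compact_convergence_topology
      proof (intro conjI ballI)
        show "U \<subseteq> extensional D" by (auto simp: U_def)
        fix g assume "g \<in> U"
        then obtain d where d: "d < e" "\<forall>z\<in>K. dist (g z) (l z) < d"
          by (auto simp: U_def)
        have "{h \<in> extensional D. \<forall>z\<in>K. dist (h z) (g z) < (e - d) / 2} \<subseteq> U"
        proof
          fix h assume h: "h \<in> {h \<in> extensional D. \<forall>z\<in>K. dist (h z) (g z) < (e - d) / 2}"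
          have "dist (h z) (l z) < (e + d) / 2" if "z \<in> K" for z
          proof -
            have "dist (h z) (l z) \<le> dist (h z) (g z) + dist (g z) (l z)"
              by (rule dist_triangle)
            also have "\<dots> < (e - d) / 2 + d"
              using h d(2) that by (intro add_strict_mono) auto
            finally show ?thesis by (simp add: field_simps)
          qed
          moreover have "(e + d) / 2 < e" using d(1) by simp
          ultimately show "h \<in> U" using h unfolding U_def by blast
        qed
        then show "\<exists>K \<epsilon>. compact K \<and> K \<subseteq> D \<and> \<epsilon> > 0 \<and>
            {h \<in> extensional D. \<forall>z\<in>K. dist (h z) (g z) < \<epsilon>} \<subseteq> U"
          using K d(1) by (intro exI[of _ K] exI[of _ "(e - d) / 2"]) auto
      qed
      moreover have "l \<in> U"
        using assms(1) \<open>e > 0\<close> unfolding U_def by (auto intro!: exI[of _ "e / 2"])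
      ultimately have "\<forall>\<^sub>F x in F. f x \<in> U"
        using L unfolding limitin_def by blast
      then show "\<forall>\<^sub>F x in F. \<forall>z\<in>K. dist (f x z) (l z) < e"
        by (rule eventually_mono) (auto simp: U_def intro: less_trans)
    qed
  qed
next
  assume R: "\<forall>K. compact K \<longrightarrow> K \<subseteq> D \<longrightarrow> uniform_limit K f l F"
  show "limitin (compact_convergence_topology D) f l F"
    unfolding limitin_def
  proof (intro conjI allI impI)
    show "l \<in> topspace (compact_convergence_topology D)"
      using assms(1) by simp
    fix U assume "openin (compact_convergence_topology D) U \<and> l \<in> U"
    then have "\<exists>K \<epsilon>. compact K \<and> K \<subseteq> D \<and> \<epsilon> > 0 \<and>
        {g \<in> extensional D. \<forall>z\<in>K. dist (g z) (l z) < \<epsilon>} \<subseteq> U"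
      by (simp add: openin_compact_convergence_topology)
    then obtain K \<epsilon> where K: "compact K" "K \<subseteq> D" "\<epsilon> > 0"
      "{g \<in> extensional D. \<forall>z\<in>K. dist (g z) (l z) < \<epsilon>} \<subseteq> U"
      by (elim exE conjE)
    have "\<forall>\<^sub>F x in F. \<forall>z\<in>K. dist (f x z) (l z) < \<epsilon>"
      using uniform_limitD[OF R[rule_format, OF K(1,2)] K(3)] .
    then show "\<forall>\<^sub>F x in F. f x \<in> U"
      by (rule eventually_mono) (use K(4) assms(2) in blast)
  qed
qed

definition theta2 :: real where
  "theta2 = inverse ((1 + sqrt 5) / 2)"

definition Parry_family :: "(complex \<Rightarrow> complex) set" where
  "Parry_family = Parry_upper_disk ` {1<..<inverse theta2}"

abbreviation disk_topology :: "(complex \<Rightarrow> complex) topology" where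
  "disk_topology \<equiv> compact_convergence_topology unit_disk"

abbreviation Parry_family_topology :: "(complex \<Rightarrow> complex) topology" where
  "Parry_family_topology \<equiv> subtopology disk_topology Parry_family"

end

theory Submission
  imports Defs
begin

text \<open>
  All digits of \<open>d\<^sub>\<gamma>(1)\<close> are bounded by \<open>\<gamma>\<close>, so convergence on compact subsets of the disk follows
  by dominated convergence once every single digit is eventually constant as \<open>\<gamma>\<close> tends to \<open>\<beta>\<close> from one side. By
  induction, \<open>T\<^sub>\<gamma>\<^sup>n(1)\<close> tends to \<open>T\<^sub>\<beta>\<^sup>n(1)\<close> from above as \<open>\<gamma> \<rightarrow> \<beta>\<^sup>+\<close>, and right-continuity of the floor
  fixes the digits. As \<open>\<gamma> \<rightarrow> \<beta>\<^sup>-\<close>, the orbit tends from below to the orbit of 1 under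
  the left-continuous version \<open>x \<mapsto> \<beta> x - (\<lceil>\<beta> x\<rceil> - 1)\<close> of \<open>T\<^sub>\<beta>\<close>, with digits \<open>\<lceil>\<beta> x\<rceil> - 1\<close>. The two
  orbits coincide until \<open>T\<^sub>\<beta>\<close> reaches 0; there the left-continuous one returns to 1, so in the simple
  case its digit sequence is periodic with period \<open>t\<^sub>1, \<dots>, t\<^sub>N\<^sub>-\<^sub>1, t\<^sub>N - 1\<close>.
\<close>

section \<open>Convergence of power series with bounded convergent coefficients\<close>

lemma summable_bounded_coeffs:
  fixes a :: "nat \<Rightarrow> 'a::{real_normed_field,banach}"
  assumes "\<And>i. norm (a i) \<le> M" and "norm z < 1"
  shows "summable (\<lambda>i. norm (a i * z ^ Suc i))"
proof (rule summable_comparison_test')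
  show "summable (\<lambda>i. M * norm z * norm z ^ i)"
    using assms(2) by (intro summable_mult summable_geometric) simp
  show "norm (norm (a i * z ^ Suc i)) \<le> M * norm z * norm z ^ i" for i
    using mult_right_mono[OF assms(1)[of i], of "norm z ^ Suc i"]
    by (simp add: norm_mult norm_power mult.assoc)
qed

text \<open>On \<open>K\<close> the difference of the two series is dominated by one scalar series
  at the largest radius \<open>r\<close> attained in \<open>K\<close>, and Tannery's theorem sends
  that series to 0.\<close>

lemma uniform_limit_power_series:
  fixes c :: "'b \<Rightarrow> nat \<Rightarrow> complex" and d :: "nat \<Rightarrow> complex"
  assumes K: "compact K" "K \<subseteq> ball 0 1"
    and bound: "\<forall>\<^sub>F x in F. \<forall>i. norm (c x i) \<le> M"
    and lim: "\<And>i. ((\<lambda>x. c x i) \<longlongrightarrow> d i) F"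
    and d: "\<And>i. norm (d i) \<le> M"
  shows "uniform_limit K (\<lambda>x z. \<Sum>i. c x i * z ^ Suc i) (\<lambda>z. \<Sum>i. d i * z ^ Suc i) F"
\<comment> \<open>A point of maximal modulus requires \<open>K\<close> to be nonempty, and Tannery's
  theorem requires a proper filter.\<close>
proof (cases "K = {} \<or> F = bot")
  case True
  then show ?thesis
    by (auto simp: uniform_limit_iff)
next
  case False
  then obtain w where w: "w \<in> K" "\<And>z. z \<in> K \<Longrightarrow> norm z \<le> norm w"
    using continuous_attains_sup[OF K(1), of norm] by (auto intro: continuous_intros)
  define r where "r = norm w"
  have r: "0 \<le> r" "r < 1"
    using w(1) K(2) by (auto simp: r_def)
  have coeff: "norm (c x i - d i) \<le> 2 * M" if "\<forall>i. norm (c x i) \<le> M" for x i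
    using norm_triangle_ineq4[of "c x i" "d i"] that[rule_format, of i] d[of i] by linarith
  have "((\<lambda>x. \<Sum>i. norm (c x i - d i) * r ^ Suc i) \<longlongrightarrow> (\<Sum>i. 0 :: real)) F"
  proof (rule tannerys_theorem[THEN conjunct2, THEN conjunct2])
    show "((\<lambda>x. norm (c x i - d i) * r ^ Suc i) \<longlongrightarrow> 0) F" for i
      by (intro tendsto_mult_left_zero tendsto_norm_zero) (use lim[of i] LIM_zero in blast)
    \<comment> \<open>Since \<open>bound\<close> is uniform in \<open>i\<close>, only the second
      component of the product filter matters.\<close>
    show "\<forall>\<^sub>F (i, x) in at_top \<times>\<^sub>F F. norm (norm (c x i - d i) * r ^ Suc i) \<le> 2 * M * r * r ^ i"
    proof -
      have ev: "\<forall>\<^sub>F p in at_top \<times>\<^sub>F F. \<forall>i. norm (c (snd p) i) \<le> M"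
        using bound filterlim_snd by (rule eventually_compose_filterlim)
      have "norm (norm (c x i - d i) * r ^ Suc i) \<le> 2 * M * r * r ^ i"
        if "\<forall>i. norm (c x i) \<le> M" for x i
        using mult_right_mono[OF coeff[OF that], of "r ^ Suc i" i] r(1)
        by (simp add: mult.assoc)
      with ev show ?thesis
        unfolding case_prod_beta by (rule eventually_mono)
    qed
    show "summable (\<lambda>i. 2 * M * r * r ^ i)"
      using r by (intro summable_mult summable_geometric) simp
    show "F \<noteq> bot"
      using False by simp
  qed
  then have major: "((\<lambda>x. \<Sum>i. norm (c x i - d i) * r ^ Suc i) \<longlongrightarrow> 0) F"
    by simp
  have le: "dist (\<Sum>i. c x i * z ^ Suc i) (\<Sum>i. d i * z ^ Suc i) \<le> (\<Sum>i. norm (c x i - d i) * r ^ Suc i)"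
    if c: "\<forall>i. norm (c x i) \<le> M" and z: "z \<in> K" for x z
  proof -
    have z1: "norm z < 1" and zr: "norm z \<le> r"
      using z K(2) w(2) by (auto simp: r_def)
    note cd = coeff[OF c]
    have "(\<Sum>i. c x i * z ^ Suc i) - (\<Sum>i. d i * z ^ Suc i) = (\<Sum>i. (c x i - d i) * z ^ Suc i)"
      using summable_norm_cancel[OF summable_bounded_coeffs[of "c x" M z]]
        summable_norm_cancel[OF summable_bounded_coeffs[of d M z]] c d z1
      by (subst suminf_diff) (auto simp: left_diff_distrib)
    moreover have "norm (\<Sum>i. (c x i - d i) * z ^ Suc i) \<le> (\<Sum>i. norm ((c x i - d i) * z ^ Suc i))"
      by (intro summable_norm summable_bounded_coeffs[of _ "2 * M"] cd z1)
    moreover have "(\<Sum>i. norm ((c x i - d i) * z ^ Suc i)) \<le> (\<Sum>i. norm (c x i - d i) * r ^ Suc i)"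
    proof (rule suminf_le)
      show "norm ((c x i - d i) * z ^ Suc i) \<le> norm (c x i - d i) * r ^ Suc i" for i
        unfolding norm_mult norm_power by (intro mult_left_mono power_mono zr) auto
      show "summable (\<lambda>i. norm ((c x i - d i) * z ^ Suc i))"
        by (intro summable_bounded_coeffs[of _ "2 * M"] cd z1)
      show "summable (\<lambda>i. norm (c x i - d i) * r ^ Suc i)"
        using summable_norm_cancel[OF summable_bounded_coeffs[of "\<lambda>i. norm (c x i - d i)" "2 * M" r]]
          cd r by simp
    qed
    ultimately show ?thesis
      by (simp add: dist_norm)
  qed
  show ?thesis
  proof (rule uniform_limitI)
    fix e :: real assume "e > 0"
    then have "\<forall>\<^sub>F x in F. (\<Sum>i. norm (c x i - d i) * r ^ Suc i) < e"
      using major by (rule order_tendstoD(2)[rotated])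
    with bound show "\<forall>\<^sub>F x in F. \<forall>z\<in>K. dist (\<Sum>i. c x i * z ^ Suc i) (\<Sum>i. d i * z ^ Suc i) < e"
      by eventually_elim (use le in \<open>blast intro: le_less_trans\<close>)
  qed
qed

section \<open>Convergence of the digits\<close>

abbreviation beta_orbit :: "real \<Rightarrow> nat \<Rightarrow> real" where
  "beta_orbit \<beta> n \<equiv> (beta_trans \<beta> ^^ n) 1"

lemma beta_orbit_Suc: "beta_orbit \<beta> (Suc n) = \<beta> * beta_orbit \<beta> n - digit \<beta> (Suc n)"
  by (simp add: beta_trans_def digit_def frac_def)

lemma digit_bounds:
  assumes "\<beta> \<ge> 0"
  shows "0 \<le> digit \<beta> (Suc n)" "real_of_int (digit \<beta> (Suc n)) \<le> \<beta>"
proof -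
  show "0 \<le> digit \<beta> (Suc n)"
    using assms beta_trans_iter_bounds(1)[where \<beta> = \<beta> and n = n] by (simp add: digit_def)
  have "real_of_int (digit \<beta> (Suc n)) \<le> \<beta> * beta_orbit \<beta> n"
    by (simp add: digit_def)
  also have "\<dots> \<le> \<beta>"
    using assms beta_trans_iter_bounds(2)[where \<beta> = \<beta> and n = n] mult_left_mono by fastforce
  finally show "real_of_int (digit \<beta> (Suc n)) \<le> \<beta>" .
qed

text \<open>\<open>\<lceil>y\<rceil> - 1\<close> is the largest integer strictly below y, so the
  remainder lies in (0,1] instead of [0,1): an integer y yields 1 where \<open>beta_trans\<close>
  yields 0.\<close>

definition left_orbit :: "real \<Rightarrow> nat \<Rightarrow> real" where
  "left_orbit \<beta> n = ((\<lambda>x. \<beta> * x - (\<lceil>\<beta> * x\<rceil> - 1)) ^^ n) 1"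

text \<open>Unlike \<^const>\<open>digit\<close>, the sequence of left digits is indexed from 0.\<close>

definition left_digit :: "real \<Rightarrow> nat \<Rightarrow> int" where
  "left_digit \<beta> n = \<lceil>\<beta> * left_orbit \<beta> n\<rceil> - 1"

lemma left_orbit_0 [simp]: "left_orbit \<beta> 0 = 1"
  by (simp add: left_orbit_def)

lemma left_orbit_Suc: "left_orbit \<beta> (Suc n) = \<beta> * left_orbit \<beta> n - left_digit \<beta> n"
  by (simp add: left_orbit_def left_digit_def)

lemma left_orbit_pos: "0 < left_orbit \<beta> n"
  by (cases n) (auto simp: left_orbit_Suc left_digit_def, linarith)

text \<open>Convergence alone does not fix the floor when
  \<open>\<beta> * beta_orbit \<beta> n\<close> is an integer; approach from above does. Hence the
  limit and the inequality go through the induction together.\<close>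

lemma tendsto_beta_orbit_at_right:
  assumes "\<beta> > 0"
  shows "((\<lambda>\<gamma>. beta_orbit \<gamma> n) \<longlongrightarrow> beta_orbit \<beta> n) (at_right \<beta>) \<and>
    (\<forall>\<^sub>F \<gamma> in at_right \<beta>. beta_orbit \<beta> n \<le> beta_orbit \<gamma> n \<and> digit \<gamma> (Suc n) = digit \<beta> (Suc n))"
proof -
  have digits: "\<forall>\<^sub>F \<gamma> in at_right \<beta>. \<beta> * beta_orbit \<beta> n \<le> \<gamma> * beta_orbit \<gamma> n \<and>
      digit \<gamma> (Suc n) = digit \<beta> (Suc n)"
    if lim: "((\<lambda>\<gamma>. beta_orbit \<gamma> n) \<longlongrightarrow> beta_orbit \<beta> n) (at_right \<beta>)"
      and ge: "\<forall>\<^sub>F \<gamma> in at_right \<beta>. beta_orbit \<beta> n \<le> beta_orbit \<gamma> n" for n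
  proof -
    have "((\<lambda>\<gamma>. \<gamma> * beta_orbit \<gamma> n) \<longlongrightarrow> \<beta> * beta_orbit \<beta> n) (at_right \<beta>)"
      by (intro tendsto_mult lim tendsto_ident_at)
    moreover have "\<beta> * beta_orbit \<beta> n < \<lfloor>\<beta> * beta_orbit \<beta> n\<rfloor> + 1"
      by linarith
    ultimately have "\<forall>\<^sub>F \<gamma> in at_right \<beta>. \<gamma> * beta_orbit \<gamma> n < \<lfloor>\<beta> * beta_orbit \<beta> n\<rfloor> + 1"
      by (rule order_tendstoD(2))
    then show ?thesis
      using ge eventually_at_right_less[of \<beta>]
    proof eventually_elim
      case (elim \<gamma>)
      have "\<beta> * beta_orbit \<beta> n \<le> \<gamma> * beta_orbit \<gamma> n"
        using elim assms beta_trans_iter_bounds(1)[where \<beta> = \<beta> and n = n] by (intro mult_mono) auto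
      moreover from this have "\<lfloor>\<gamma> * beta_orbit \<gamma> n\<rfloor> = \<lfloor>\<beta> * beta_orbit \<beta> n\<rfloor>"
        using elim(1) by (intro floor_unique) linarith+
      ultimately show ?case
        by (simp add: digit_def)
    qed
  qed
  have "((\<lambda>\<gamma>. beta_orbit \<gamma> n) \<longlongrightarrow> beta_orbit \<beta> n) (at_right \<beta>) \<and>
    (\<forall>\<^sub>F \<gamma> in at_right \<beta>. beta_orbit \<beta> n \<le> beta_orbit \<gamma> n)"
  proof (induction n)
    case (Suc n)
    note ev = digits[OF conjunct1[OF Suc] conjunct2[OF Suc]]
    \<comment> \<open>Once the digit is frozen at its value for \<beta>, the next iterate is
      continuous in the previous one.\<close>
    have "((\<lambda>\<gamma>. \<gamma> * beta_orbit \<gamma> n - digit \<beta> (Suc n)) \<longlongrightarrow> beta_orbit \<beta> (Suc n)) (at_right \<beta>)"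
      unfolding beta_orbit_Suc by (intro tendsto_intros conjunct1[OF Suc])
    then have "((\<lambda>\<gamma>. beta_orbit \<gamma> (Suc n)) \<longlongrightarrow> beta_orbit \<beta> (Suc n)) (at_right \<beta>)"
      by (rule Lim_transform_eventually)
        (use ev in eventually_elim, simp add: beta_orbit_Suc del: funpow.simps)
    moreover have "\<forall>\<^sub>F \<gamma> in at_right \<beta>. beta_orbit \<beta> (Suc n) \<le> beta_orbit \<gamma> (Suc n)"
      using ev by eventually_elim (simp add: beta_orbit_Suc del: funpow.simps)
    ultimately show ?case ..
  qed simp
  with digits[of n] show ?thesis
    by (auto simp: eventually_conj_iff)
qed

text \<open>From below, products approaching an integer k have floor k - 1, which is the left digit.
  The mirrored induction therefore follows \<open>left_orbit\<close>.\<close>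

lemma tendsto_beta_orbit_at_left:
  assumes "\<beta> > 0"
  shows "((\<lambda>\<gamma>. beta_orbit \<gamma> n) \<longlongrightarrow> left_orbit \<beta> n) (at_left \<beta>) \<and>
    (\<forall>\<^sub>F \<gamma> in at_left \<beta>. beta_orbit \<gamma> n \<le> left_orbit \<beta> n \<and> digit \<gamma> (Suc n) = left_digit \<beta> n)"
proof -
  have digits: "\<forall>\<^sub>F \<gamma> in at_left \<beta>. \<gamma> * beta_orbit \<gamma> n \<le> \<beta> * left_orbit \<beta> n \<and>
      digit \<gamma> (Suc n) = left_digit \<beta> n"
    if lim: "((\<lambda>\<gamma>. beta_orbit \<gamma> n) \<longlongrightarrow> left_orbit \<beta> n) (at_left \<beta>)"
      and le: "\<forall>\<^sub>F \<gamma> in at_left \<beta>. beta_orbit \<gamma> n \<le> left_orbit \<beta> n" for n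
  proof -
    have "((\<lambda>\<gamma>. \<gamma> * beta_orbit \<gamma> n) \<longlongrightarrow> \<beta> * left_orbit \<beta> n) (at_left \<beta>)"
      by (intro tendsto_mult lim tendsto_ident_at)
    moreover have "left_digit \<beta> n < \<beta> * left_orbit \<beta> n"
      unfolding left_digit_def by linarith
    ultimately have "\<forall>\<^sub>F \<gamma> in at_left \<beta>. left_digit \<beta> n < \<gamma> * beta_orbit \<gamma> n"
      by (rule order_tendstoD(1))
    moreover have "\<forall>\<^sub>F \<gamma> in at_left \<beta>. 0 < \<gamma>"
      using assms by (intro order_tendstoD(1)[OF tendsto_ident_at])
    moreover have "\<forall>\<^sub>F \<gamma> in at_left \<beta>. \<gamma> < \<beta>"
      by (simp add: eventually_at_filter)
    ultimately show ?thesis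
      using le
    proof eventually_elim
      case (elim \<gamma>)
      have "\<gamma> * beta_orbit \<gamma> n \<le> \<gamma> * left_orbit \<beta> n"
        using elim by (intro mult_left_mono) auto
      \<comment> \<open>Positivity of the left orbit makes this strict; strictness excludes the next
        integer when the right-hand side is itself an integer.\<close>
      also have "\<dots> < \<beta> * left_orbit \<beta> n"
        using elim left_orbit_pos[of \<beta> n] by (intro mult_strict_right_mono) auto
      finally have less: "\<gamma> * beta_orbit \<gamma> n < \<beta> * left_orbit \<beta> n" .
      moreover have "\<lfloor>\<gamma> * beta_orbit \<gamma> n\<rfloor> = left_digit \<beta> n"
        using elim(1) less unfolding left_digit_def by (intro floor_unique) linarith+
      ultimately show ?case
        by (simp add: digit_def)
    qed
  qed
  have "((\<lambda>\<gamma>. beta_orbit \<gamma> n) \<longlongrightarrow> left_orbit \<beta> n) (at_left \<beta>) \<and>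
    (\<forall>\<^sub>F \<gamma> in at_left \<beta>. beta_orbit \<gamma> n \<le> left_orbit \<beta> n)"
  proof (induction n)
    case (Suc n)
    note ev = digits[OF conjunct1[OF Suc] conjunct2[OF Suc]]
    have "((\<lambda>\<gamma>. \<gamma> * beta_orbit \<gamma> n - left_digit \<beta> n) \<longlongrightarrow> left_orbit \<beta> (Suc n)) (at_left \<beta>)"
      unfolding left_orbit_Suc by (intro tendsto_intros conjunct1[OF Suc])
    then have "((\<lambda>\<gamma>. beta_orbit \<gamma> (Suc n)) \<longlongrightarrow> left_orbit \<beta> (Suc n)) (at_left \<beta>)"
      by (rule Lim_transform_eventually)
        (use ev in eventually_elim, simp add: beta_orbit_Suc del: funpow.simps)
    moreover have "\<forall>\<^sub>F \<gamma> in at_left \<beta>. beta_orbit \<gamma> (Suc n) \<le> left_orbit \<beta> (Suc n)"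
      using ev by eventually_elim (simp add: beta_orbit_Suc left_orbit_Suc del: funpow.simps)
    ultimately show ?case ..
  qed simp
  with digits[of n] show ?thesis
    by (auto simp: eventually_conj_iff)
qed

section \<open>Convergence of the Parry Upper function\<close>

text \<open>Serves both one-sided limits: \<open>d\<close> is the limiting digit sequence, and
  \<open>g\<close> may be any closed form of its series on the disk.\<close>

lemma limitin_Parry_upper_disk:
  assumes at: "((\<lambda>\<gamma>. \<gamma>) \<longlongrightarrow> \<beta>) F" and "\<beta> > 0" and "F \<noteq> bot"
    and digits: "\<And>i. \<forall>\<^sub>F \<gamma> in F. digit \<gamma> (Suc i) = d i"
    and g: "\<And>z. norm z < 1 \<Longrightarrow> g z = -1 + (\<Sum>i. of_int (d i) * z ^ Suc i)"
  shows "limitin disk_topology Parry_upper_disk (restrict g unit_disk) F"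
proof -
  have pos: "\<forall>\<^sub>F \<gamma> in F. 0 < \<gamma>" and ub: "\<forall>\<^sub>F \<gamma> in F. \<gamma> < \<beta> + 1"
    using order_tendstoD[OF at] \<open>\<beta> > 0\<close> by auto
  have bound: "\<forall>\<^sub>F \<gamma> in F. \<forall>i. norm (of_int (digit \<gamma> (Suc i)) :: complex) \<le> \<beta> + 1"
    using pos ub
  proof eventually_elim
    case (elim \<gamma>)
    then show ?case
      using digit_bounds[of \<gamma>] by (smt (verit) norm_of_int of_int_nonneg)
  qed
  \<comment> \<open>As \<open>F\<close> is proper, each \<open>d i\<close> is a digit of some
    \<gamma> satisfying \<open>bound\<close>, so it inherits the bound.\<close>
  have d_bound: "norm (of_int (d i) :: complex) \<le> \<beta> + 1" for i
  proof -
    have "\<forall>\<^sub>F \<gamma> in F. norm (of_int (d i) :: complex) \<le> \<beta> + 1"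
      using bound digits[of i] by eventually_elim metis
    then show ?thesis
      using \<open>F \<noteq> bot\<close> by simp
  qed
  have "uniform_limit K Parry_upper_disk (restrict g unit_disk) F"
    if K: "compact K" "K \<subseteq> unit_disk" for K
  proof -
    have "uniform_limit K (\<lambda>\<gamma> z. \<Sum>i. of_int (digit \<gamma> (Suc i)) * z ^ Suc i)
        (\<lambda>z. \<Sum>i. of_int (d i) * z ^ Suc i) F"
    proof (rule uniform_limit_power_series[OF K bound _ d_bound])
      show "((\<lambda>\<gamma>. of_int (digit \<gamma> (Suc i)) :: complex) \<longlongrightarrow> of_int (d i)) F" for i
        by (rule tendsto_eventually) (use digits[of i] in eventually_elim, simp)
    qed
    then have "uniform_limit K Parry_upper (\<lambda>z. -1 + (\<Sum>i. of_int (d i) * z ^ Suc i)) F"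
      unfolding Parry_upper_def by (intro uniform_limit_intros)
    then show ?thesis
      by (rule uniform_limit_cong'[THEN iffD1, rotated 2])
        (use K g in \<open>auto simp: Parry_upper_disk_def\<close>)
  qed
  then show ?thesis
    by (subst limitin_compact_convergence_topology) (auto simp: Parry_upper_disk_def)
qed

lemma limitin_Parry_upper_disk_at_right:
  assumes "\<beta> > 0"
  shows "limitin disk_topology Parry_upper_disk (Parry_upper_disk \<beta>) (at_right \<beta>)"
  unfolding Parry_upper_disk_def[of \<beta>]
proof (rule limitin_Parry_upper_disk[where d = "\<lambda>i. digit \<beta> (Suc i)"])
  show "\<forall>\<^sub>F \<gamma> in at_right \<beta>. digit \<gamma> (Suc i) = digit \<beta> (Suc i)" for i
    using tendsto_beta_orbit_at_right[OF assms, of i] by (auto elim: eventually_mono)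
qed (use assms in \<open>auto simp: Parry_upper_def tendsto_ident_at\<close>)

lemma limitin_Parry_upper_disk_at_left:
  assumes "\<beta> > 0" and "\<And>z. norm z < 1 \<Longrightarrow> g z = -1 + (\<Sum>i. of_int (left_digit \<beta> i) * z ^ Suc i)"
  shows "limitin disk_topology Parry_upper_disk (restrict g unit_disk) (at_left \<beta>)"
proof (rule limitin_Parry_upper_disk[where d = "left_digit \<beta>"])
  show "\<forall>\<^sub>F \<gamma> in at_left \<beta>. digit \<gamma> (Suc i) = left_digit \<beta> i" for i
    using tendsto_beta_orbit_at_left[OF assms(1), of i] by (auto elim: eventually_mono)
qed (use assms in \<open>auto simp: tendsto_ident_at\<close>)

text \<open>Floor and ceiling minus one differ only at integers, and
  \<open>\<beta> * beta_orbit \<beta> n\<close> is an integer exactly when the next iterate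
  vanishes.\<close>

lemma left_digit_eq:
  assumes "left_orbit \<beta> n = beta_orbit \<beta> n"
  shows "left_digit \<beta> n = digit \<beta> (Suc n) - (if beta_orbit \<beta> (Suc n) = 0 then 1 else 0)"
proof -
  have "beta_orbit \<beta> (Suc n) = 0 \<longleftrightarrow> \<beta> * beta_orbit \<beta> n \<in> \<int>"
    by (simp add: beta_trans_def frac_eq_0_iff)
  then show ?thesis
    using assms by (auto simp: left_digit_def digit_def ceiling_altdef Ints_def simp del: funpow.simps)
qed

lemma left_orbit_eq:
  assumes "\<And>k. k \<le> n \<Longrightarrow> beta_orbit \<beta> k \<noteq> 0"
  shows "left_orbit \<beta> n = beta_orbit \<beta> n"
  using assms
proof (induction n)
  case (Suc n)
  then have "left_orbit \<beta> n = beta_orbit \<beta> n"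
    by simp
  moreover from this have "left_digit \<beta> n = digit \<beta> (Suc n)"
    using left_digit_eq[of \<beta> n] Suc.prems[of "Suc n"] by (simp del: funpow.simps)
  ultimately show ?case
    by (simp add: left_orbit_Suc beta_orbit_Suc del: funpow.simps)
qed simp

text \<open>The left digits have period \<open>N\<close>, so their series S satisfies S = B +
  \<open>z ^ N\<close> S, where B is the first block. There only the last digit is lowered, by one,
  so B = \<open>Parry_upper \<beta> z + 1 - z ^ N\<close>.\<close>

lemma left_series_simple:
  assumes "\<beta> > 0" "norm z < 1" "N > 0" and N: "beta_orbit \<beta> N = 0"
    and min: "\<And>k. k < N \<Longrightarrow> beta_orbit \<beta> k \<noteq> 0"
  shows "Parry_upper \<beta> z / (1 - z ^ N) = -1 + (\<Sum>i. of_int (left_digit \<beta> i) * z ^ Suc i)"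
proof -
  define S where "S = (\<Sum>i. of_int (left_digit \<beta> i) * z ^ Suc i)"
  obtain m where m: "N = Suc m"
    using \<open>N > 0\<close> gr0_conv_Suc by blast
  have orbit: "left_orbit \<beta> k = beta_orbit \<beta> k" if "k < N" for k
    using that min by (intro left_orbit_eq) auto
  have digits: "left_digit \<beta> k = digit \<beta> (Suc k) - (if k = m then 1 else 0)" if "k < N" for k
    using left_digit_eq[OF orbit[OF that]] N min[of "Suc k"] that m
    by (cases "k = m") (auto simp del: funpow.simps)
  \<comment> \<open>The last digit of the block, at index \<open>m\<close> from 0, is one smaller,
    so the remainder is 1 instead of 0 and the orbit restarts.\<close>
  have "left_orbit \<beta> N = 1"
    using orbit[of m] digits[of m] N beta_orbit_Suc[of m \<beta>]
    by (simp add: m left_orbit_Suc del: funpow.simps)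
  then have periodic: "left_orbit \<beta> (i + N) = left_orbit \<beta> i" for i
    unfolding left_orbit_def by (simp add: funpow_add)
  then have periodic: "left_digit \<beta> (i + N) = left_digit \<beta> i" for i
    by (simp add: left_digit_def)
  have "beta_orbit \<beta> (N + k) = 0" for k
    by (induction k) (simp_all add: N beta_trans_def[of \<beta> 0])
  then have tail: "digit \<beta> (Suc i) = 0" if "N \<le> i" for i
    using that le_Suc_ex[OF that] by (auto simp: digit_def)
  have upper: "Parry_upper \<beta> z = -1 + (\<Sum>i<N. of_int (digit \<beta> (Suc i)) * z ^ Suc i)"
    unfolding Parry_upper_def by (subst suminf_finite[of "{..<N}"]) (auto simp: tail)
  \<comment> \<open>A periodic sequence takes finitely many values; the bound gives
    summability.\<close>
  obtain M where M: "\<bar>left_digit \<beta> i\<bar> \<le> M" for i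
  proof
    fix i
    have "left_digit \<beta> i = left_digit \<beta> (i mod N)"
    proof -
      have "left_digit \<beta> (j + k * N) = left_digit \<beta> j" for j k
        by (induction k) (use periodic in \<open>simp_all add: add.assoc[symmetric] add.commute[of N]\<close>)
      then show ?thesis
        by (metis add.commute mult.commute mult_div_mod_eq)
    qed
    then show "\<bar>left_digit \<beta> i\<bar> \<le> Max ((\<lambda>i. \<bar>left_digit \<beta> i\<bar>) ` {..<N})"
      using \<open>N > 0\<close> by (auto intro!: Max_ge)
  qed
  have "norm (of_int (left_digit \<beta> i) :: complex) \<le> of_int M" for i
    using M[of i] by (simp flip: of_int_abs)
  then have "summable (\<lambda>i. of_int (left_digit \<beta> i) * z ^ Suc i)"
    by (intro summable_norm_cancel[OF summable_bounded_coeffs[of _ "of_int M"]] assms(2))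
  then have "S = (\<Sum>i. of_int (left_digit \<beta> (i + N)) * z ^ Suc (i + N)) +
      (\<Sum>i<N. of_int (left_digit \<beta> i) * z ^ Suc i)"
    and sum: "summable (\<lambda>i. of_int (left_digit \<beta> i) * z ^ Suc i)"
    unfolding S_def by (auto dest: suminf_split_initial_segment)
  moreover have "(\<Sum>i. of_int (left_digit \<beta> (i + N)) * z ^ Suc (i + N)) = z ^ N * S"
    using suminf_mult[OF sum, of "z ^ N"] by (simp add: S_def periodic power_add mult_ac)
  moreover have "(\<Sum>i<N. of_int (left_digit \<beta> i) * z ^ Suc i) = Parry_upper \<beta> z + 1 - z ^ N"
    by (simp add: upper m digits left_diff_distrib)
  ultimately have "S * (1 - z ^ N) = Parry_upper \<beta> z + (1 - z ^ N)"
    by (simp add: algebra_simps)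
  moreover have "1 - z ^ N \<noteq> 0"
    using assms(2,3) power_eq_1_iff[of z N] by auto
  ultimately show ?thesis
    unfolding S_def by (simp add: field_simps)
qed

text \<open>The parameter interval is open, so the functions for \<gamma> near \<beta> lie in the
  family and the limit passes to the subspace.\<close>

lemma limitin_Parry_family:
  assumes "limitin disk_topology Parry_upper_disk (Parry_upper_disk \<beta>) F"
    and "((\<lambda>\<gamma>. \<gamma>) \<longlongrightarrow> \<beta>) F" and "\<beta> \<in> {1<..<inverse theta2}"
  shows "limitin Parry_family_topology Parry_upper_disk (Parry_upper_disk \<beta>) F"
proof -
  have "\<forall>\<^sub>F \<gamma> in F. \<gamma> \<in> {1<..<inverse theta2}"
    using assms(2,3) by (intro topological_tendstoD) auto
  then have "\<forall>\<^sub>F \<gamma> in F. Parry_upper_disk \<gamma> \<in> Parry_family"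
    by eventually_elim (auto simp: Parry_family_def)
  then show ?thesis
    using assms by (auto simp: limitin_subtopology Parry_family_def)
qed

text \<open>The quotient is a limit in the ambient \<open>disk_topology\<close>, since its
  membership in \<open>Parry_family\<close> is not claimed.\<close>

theorem theorem4p24:
  fixes \<beta> :: real
  assumes "\<beta> \<in> {1<..<inverse theta2}"
  shows "(nonsimple_Parry_number \<beta> \<longrightarrow>
            limitin Parry_family_topology Parry_upper_disk (Parry_upper_disk \<beta>) (at_left \<beta>) \<and>
            limitin Parry_family_topology Parry_upper_disk (Parry_upper_disk \<beta>) (at_right \<beta>)) \<and>
         (\<forall>N. simple_Parry_number \<beta> \<and> N = (LEAST n. (beta_trans \<beta> ^^ n) 1 = 0) \<longrightarrow>
            limitin Parry_family_topology Parry_upper_disk (Parry_upper_disk \<beta>) (at_right \<beta>) \<and>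
            limitin disk_topology Parry_upper_disk
              (\<lambda>z\<in>unit_disk. Parry_upper \<beta> z / (1 - z ^ N)) (at_left \<beta>))"
proof -
  have \<beta>: "\<beta> > 1"
    using assms by simp
  have right: "limitin Parry_family_topology Parry_upper_disk (Parry_upper_disk \<beta>) (at_right \<beta>)"
    using \<beta> by (intro limitin_Parry_family limitin_Parry_upper_disk_at_right tendsto_ident_at assms) simp
  have left: "limitin Parry_family_topology Parry_upper_disk (Parry_upper_disk \<beta>) (at_left \<beta>)"
    if "nonsimple_Parry_number \<beta>"
  proof -
    \<comment> \<open>In the nonsimple case the orbit never reaches 0, so the left-continuous orbit
      never departs from it and both limits agree.\<close>
    have nz: "beta_orbit \<beta> n \<noteq> 0" for n
      using that finite_expansion_iff[OF \<beta>]
      by (auto simp: nonsimple_Parry_number_def simple_Parry_number_def)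
    then have "left_digit \<beta> i = digit \<beta> (Suc i)" for i
      using left_digit_eq[OF left_orbit_eq, of i \<beta>] by (simp del: funpow.simps)
    then have "limitin disk_topology Parry_upper_disk (restrict (Parry_upper \<beta>) unit_disk) (at_left \<beta>)"
      using \<beta> by (intro limitin_Parry_upper_disk_at_left) (simp_all add: Parry_upper_def)
    then show ?thesis
      by (intro limitin_Parry_family tendsto_ident_at assms) (simp add: Parry_upper_disk_def[of \<beta>])
  qed
  have "limitin disk_topology Parry_upper_disk
      (\<lambda>z\<in>unit_disk. Parry_upper \<beta> z / (1 - z ^ N)) (at_left \<beta>)"
    if simple: "simple_Parry_number \<beta>" and N: "N = (LEAST n. beta_orbit \<beta> n = 0)" for N
  proof -
    have "\<exists>n. beta_orbit \<beta> n = 0"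
      using simple finite_expansion_iff[OF \<beta>] by (simp add: simple_Parry_number_def)
    then have zero: "beta_orbit \<beta> N = 0"
      unfolding N by (rule LeastI_ex)
    have min: "beta_orbit \<beta> k \<noteq> 0" if "k < N" for k
      using that not_less_Least unfolding N by blast
    have "N > 0"
      using zero by (cases N) auto
    then show ?thesis
      using \<beta> zero min by (intro limitin_Parry_upper_disk_at_left left_series_simple) auto
  qed
  with left right show ?thesis
    by blast
qed

end
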